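(* Let $S$ be a commutative unital semiring with zero containing an element of infinite multiplicative order, and let $n$ be a positive integer. The right patience sorting monoid $\mathrm{rPS}_n$ of rank $n$ admits a faithful representation by upper triangular matrices of size $2^{n-1}(n^2+n)$ over $S$ (that is, an injective monoid homomorphism $\mathrm{rPS}_n\to\mathrm{UT}_{2^{n-1}(n^2+n)}(S)$).
   Context: $[n]=\{1,\dots,n\}$, and $[n]^*$ is the free monoid on $[n]$. $\mathrm{UT}_m(S)$ is the monoid of $m\times m$ upper triangular matrices over the semiring $S$ (entries below the diagonal equal to $0_S$) under matrix multiplication. An rPS-tableau is a finite array of positive integers in which columns are bottom-aligned, the entries in the bottom row are strictly increasing from left to right, and the entries in each column are non-increasing from top to bottom. Insertion of a symbol $a$ into an rPS-tableau $T$: if $a$ is greater than every symbol in the bottom row of $T$, add $a$ to the right of the bottom row (as a new column). Otherwise let $C$ be the leftmost column whose bottom-most symbol is greater than or equal to $a$; slide $C$ up by one space and add $a$ as the new bottom entry of $C$. For a word $u$ over the positive integers, $\mathrm{P}_{\mathrm{rPS}}(u)$ is the tableau obtained from the empty tableau by inserting the symbols of $u$ from left to right. The relation $u\equiv_{\mathrm{rPS}}v\iff\mathrm{P}_{\mathrm{rPS}}(u)=\mathrm{P}_{\mathrm{rPS}}(v)$ is a congruence, and $\mathrm{rPS}_n=[n]^*/{\equiv_{\mathrm{rPS}}}$. *)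

theory Defs
  imports "HOL-Algebra.Group" "Jordan_Normal_Form.Matrix"
begin

text \<open>
  An array with bottom-aligned columns is the list of its columns from left to right. Each column
  is a nonempty list read from bottom to top, so its head is the entry in the bottom row, and
  ``non-increasing from top to bottom'' becomes \<^const>\<open>sorted\<close>.
\<close>

type_synonym tableau = "nat list list"

definition rPS_tableau :: "tableau \<Rightarrow> bool" where
  "rPS_tableau T \<longleftrightarrow>
     (\<forall>C \<in> set T. C \<noteq> [] \<and> sorted C \<and> (\<forall>a \<in> set C. 0 < a)) \<and>
     sorted_wrt (<) (map hd T)"

text \<open>
  The recursion scans the columns from the left: the symbol goes under the first column whose
  bottom entry is at least as large, and starts a new column on the right if there is none.
\<close>

fun rPS_insert :: "nat \<Rightarrow> tableau \<Rightarrow> tableau" where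
  "rPS_insert a [] = [[a]]"
| "rPS_insert a (C # T) = (if a \<le> hd C then (a # C) # T else C # rPS_insert a T)"

definition P_rPS :: "nat list \<Rightarrow> tableau" where
  "P_rPS u = fold rPS_insert u []"

definition rPS_rel :: "nat \<Rightarrow> (nat list \<times> nat list) set" where
  "rPS_rel n = {(u, v). u \<in> lists {1..n} \<and> v \<in> lists {1..n} \<and> P_rPS u = P_rPS v}"

text \<open>
  The union in the multiplication is over all choices of representatives; by
  \<open>rPS_rel_congruent\<close> below all of them give the same class.
\<close>

definition rPS :: "nat \<Rightarrow> nat list set monoid" where
  "rPS n = \<lparr>carrier = lists {1..n} // rPS_rel n,
            mult = (\<lambda>A B. \<Union>u\<in>A. \<Union>v\<in>B. rPS_rel n `` {u @ v}),
            one = rPS_rel n `` {[]}\<rparr>"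

definition UT :: "nat \<Rightarrow> 'a::semiring_1 mat monoid" where
  "UT m = \<lparr>carrier = {A \<in> carrier_mat m m. upper_triangular A}, mult = (*), one = 1\<^sub>m m\<rparr>"

lemma hd_rPS_insert:
  "b \<in> set (map hd (rPS_insert a T)) \<Longrightarrow> b = a \<or> b \<in> set (map hd T)"
  by (induction T) (auto split: if_splits)

lemma rPS_tableau_insert:
  assumes "rPS_tableau T" "0 < a"
  shows "rPS_tableau (rPS_insert a T)"
  using assms
proof (induction T)
  case Nil
  then show ?case by (simp add: rPS_tableau_def)
next
  case (Cons C T)
  have T: "rPS_tableau T" and C: "C \<noteq> []" "sorted C" "\<forall>a \<in> set C. 0 < a"
    and lt: "\<forall>b \<in> set (map hd T). hd C < b"
    using Cons.prems by (auto simp: rPS_tableau_def)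
  show ?case
  proof (cases "a \<le> hd C")
    case True
    have "\<forall>c \<in> set C. a \<le> c"
      using True C by (cases C) auto
    moreover have "\<forall>b \<in> set (map hd T). a < b"
      using True lt by auto
    ultimately show ?thesis
      using T C \<open>0 < a\<close> by (auto simp: rPS_tableau_def)
  next
    case False
    have "\<forall>b \<in> set (map hd (rPS_insert a T)). hd C < b"
      using hd_rPS_insert[of _ a T] lt False by fastforce
    then show ?thesis
      using Cons.IH[OF T] C False Cons.prems(2) by (auto simp: rPS_tableau_def)
  qed
qed

lemma rPS_tableau_P_rPS: "0 \<notin> set u \<Longrightarrow> rPS_tableau (P_rPS u)"
proof (induction u rule: rev_induct)
  case Nil
  then show ?case by (simp add: P_rPS_def rPS_tableau_def)
next
  case (snoc a u)
  then show ?case by (simp add: P_rPS_def rPS_tableau_insert)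
qed

text \<open>
  Prefixing a word by a letter acts on its tableau: \<open>rPS_prefix [a] (P_rPS u) = P_rPS (a # u)\<close>.
\<close>

fun rPS_prefix :: "nat list \<Rightarrow> tableau \<Rightarrow> tableau" where
  "rPS_prefix D [] = [D]"
| "rPS_prefix D (C # T) =
     (takeWhile (\<lambda>b. b \<le> hd D) C @ D) #
     (let R = dropWhile (\<lambda>b. b \<le> hd D) C in if R = [] then T else rPS_prefix R T)"

lemma rPS_prefix_small:
  assumes "\<forall>C \<in> set T. C \<noteq> []" "sorted_wrt (<) (map hd (D # T))"
  shows "rPS_prefix D T = D # T"
  using assms
proof (induction T arbitrary: D)
  case (Cons C T)
  then have "\<not> hd C \<le> hd D" "C \<noteq> []" by auto
  then have "takeWhile (\<lambda>b. b \<le> hd D) C = []" "dropWhile (\<lambda>b. b \<le> hd D) C = C"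
    by (cases C; simp)+
  then show ?case using Cons by simp
qed simp

lemma rPS_insert_prefix:
  assumes "rPS_tableau T" "D \<noteq> []"
  shows "rPS_insert a (rPS_prefix D T) = rPS_prefix D (rPS_insert a T)"
  using assms
proof (induction T arbitrary: D)
  case Nil
  then show ?case by (cases D) auto
next
  case (Cons C T)
  obtain c C' where C: "C = c # C'"
    using Cons.prems by (cases C) (auto simp: rPS_tableau_def)
  obtain d D' where D: "D = d # D'"
    using Cons.prems by (cases D) auto
  have T: "rPS_tableau T" using Cons.prems by (simp add: rPS_tableau_def)
  have ne: "\<forall>C \<in> set T. C \<noteq> []" and lt: "sorted_wrt (<) (map hd (C # T))"
    using Cons.prems by (auto simp: rPS_tableau_def)
  show ?case
  proof (cases "a \<le> c")
    case True
    show ?thesis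
    proof (cases "a \<le> d")
      case True
      with \<open>a \<le> c\<close> show ?thesis by (simp add: C D)
    next
      case False
      have "sorted_wrt (<) (map hd ((a # C) # T))"
        using lt True C by auto
      then have "rPS_prefix (a # C) T = (a # C) # T" "rPS_prefix C T = C # T"
        using rPS_prefix_small[OF ne] lt by blast+
      then show ?thesis using True False by (simp add: C D)
    qed
  next
    case False
    then show ?thesis
      using Cons.IH[OF T, of "dropWhile (\<lambda>b. b \<le> d) C"] by (auto simp: C D Let_def)
  qed
qed

lemma P_rPS_Cons: "0 \<notin> set u \<Longrightarrow> P_rPS (a # u) = rPS_prefix [a] (P_rPS u)"
proof (induction u rule: rev_induct)
  case Nil
  then show ?case by (simp add: P_rPS_def)
next
  case (snoc b u)
  then have "P_rPS (a # u @ [b]) = rPS_insert b (rPS_prefix [a] (P_rPS u))"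
    by (simp add: P_rPS_def)
  also have "\<dots> = rPS_prefix [a] (P_rPS (u @ [b]))"
    using snoc.prems by (simp add: rPS_insert_prefix rPS_tableau_P_rPS) (simp add: P_rPS_def)
  finally show ?case by simp
qed

lemma P_rPS_append_cong:
  assumes "0 \<notin> set v" "0 \<notin> set v'" "0 \<notin> set u" "P_rPS u = P_rPS u'" "P_rPS v = P_rPS v'"
  shows "P_rPS (u @ v) = P_rPS (u' @ v')"
proof -
  have "P_rPS (u @ v) = P_rPS (u @ v')"
    using assms(3)
  proof (induction u)
    case (Cons a u)
    then show ?case
      using assms(1,2) P_rPS_Cons[of "u @ v" a] P_rPS_Cons[of "u @ v'" a] by simp
  qed (simp add: assms)
  also have "\<dots> = P_rPS (u' @ v')"
    using assms(4) by (simp add: P_rPS_def)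
  finally show ?thesis .
qed

lemma equiv_rPS_rel: "equiv (lists {1..n}) (rPS_rel n)"
  by (auto simp: rPS_rel_def intro!: equivI refl_onI symI transI)

lemma rPS_rel_append:
  assumes "(u, u') \<in> rPS_rel n" "(v, v') \<in> rPS_rel n"
  shows "(u @ v, u' @ v') \<in> rPS_rel n"
proof -
  have "0 \<notin> set w" if "w \<in> lists {1..n}" for w
    using that by (auto simp: in_lists_conv_set)
  then show ?thesis
    using assms P_rPS_append_cong[of v v' u u'] by (auto simp: rPS_rel_def)
qed

lemma rPS_rel_congruent: "congruent2 (rPS_rel n) (rPS_rel n) (\<lambda>u v. rPS_rel n `` {u @ v})"
  by (rule congruent2I') (rule equiv_class_eq[OF equiv_rPS_rel rPS_rel_append])

lemma rPS_mult_class: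
  assumes "u \<in> lists {1..n}" "v \<in> lists {1..n}"
  shows "rPS_rel n `` {u} \<otimes>\<^bsub>rPS n\<^esub> rPS_rel n `` {v} = rPS_rel n `` {u @ v}"
  using UN_equiv_class2[OF equiv_rPS_rel equiv_rPS_rel rPS_rel_congruent assms]
  by (simp add: rPS_def)

lemma carrier_rPS_class: "u \<in> lists {1..n} \<Longrightarrow> rPS_rel n `` {u} \<in> carrier (rPS n)"
  by (simp add: rPS_def quotientI)

lemma carrier_rPS_cases:
  assumes "A \<in> carrier (rPS n)"
  obtains u where "u \<in> lists {1..n}" "A = rPS_rel n `` {u}"
proof -
  have "A \<in> lists {1..n} // rPS_rel n"
    using assms by (simp add: rPS_def)
  then show thesis
    by (rule quotientE) (rule that)
qed

lemma one_rPS: "\<one>\<^bsub>rPS n\<^esub> = rPS_rel n `` {[]}"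
  by (simp add: rPS_def)

lemma monoid_rPS: "Group.monoid (rPS n)"
proof (rule Group.monoidI)
  fix A B C
  assume "A \<in> carrier (rPS n)" "B \<in> carrier (rPS n)"
  then obtain u v where *: "u \<in> lists {1..n}" "A = rPS_rel n `` {u}"
      "v \<in> lists {1..n}" "B = rPS_rel n `` {v}"
    by (metis carrier_rPS_cases)
  then show "A \<otimes>\<^bsub>rPS n\<^esub> B \<in> carrier (rPS n)"
    by (simp only: rPS_mult_class carrier_rPS_class append_in_lists_conv)
  assume "C \<in> carrier (rPS n)"
  then obtain w where "w \<in> lists {1..n}" "C = rPS_rel n `` {w}"
    by (metis carrier_rPS_cases)
  with * show "A \<otimes>\<^bsub>rPS n\<^esub> B \<otimes>\<^bsub>rPS n\<^esub> C = A \<otimes>\<^bsub>rPS n\<^esub> (B \<otimes>\<^bsub>rPS n\<^esub> C)"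
    by (simp only: rPS_mult_class append_in_lists_conv append_assoc)
next
  show "\<one>\<^bsub>rPS n\<^esub> \<in> carrier (rPS n)"
    by (simp add: one_rPS carrier_rPS_class)
next
  fix A
  assume "A \<in> carrier (rPS n)"
  then obtain u where "u \<in> lists {1..n}" "A = rPS_rel n `` {u}"
    by (metis carrier_rPS_cases)
  then show "\<one>\<^bsub>rPS n\<^esub> \<otimes>\<^bsub>rPS n\<^esub> A = A" "A \<otimes>\<^bsub>rPS n\<^esub> \<one>\<^bsub>rPS n\<^esub> = A"
    using rPS_mult_class[of "[]" n u] rPS_mult_class[of u n "[]"] by (simp_all add: one_rPS)
qed

lemma monoid_UT: "Group.monoid (UT m :: 'a::semiring_1 mat monoid)"
proof (rule Group.monoidI)
  fix A B :: "'a mat"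
  assume AB: "A \<in> carrier (UT m)" "B \<in> carrier (UT m)"
  have "(A * B) $$ (i, j) = 0" if ij: "j < i" "i < m" for i j
  proof -
    have "A $$ (i, k) * B $$ (k, j) = 0" if "k < m" for k
      using AB ij that upper_triangularD[of A k i] upper_triangularD[of B j k]
      by (cases "k < i") (auto simp: UT_def)
    then show ?thesis
      using AB ij by (auto simp: UT_def scalar_prod_def intro!: sum.neutral)
  qed
  then show "A \<otimes>\<^bsub>UT m\<^esub> B \<in> carrier (UT m)"
    using AB by (auto simp: UT_def)
qed (auto simp: UT_def)

end

theory Submission
  imports Defs
begin

text \<open>
  A tableau is determined by its number of columns and by the number of entries \<open>b\<close> in column \<open>j\<close>
  for all \<open>j\<close> and \<open>b\<close>, because each column is sorted. Where a letter goes depends on the bottom row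
  alone, and so does the next bottom row. Hence a word acts on the finite set of possible bottom
  rows, and for each pair \<open>(j, b)\<close> one can attach to a word and a starting row \<open>R\<close> the weight \<open>x ^ k\<close>,
  where \<open>k\<close> counts how often \<open>b\<close> enters column \<open>j\<close> and \<open>x\<close> has infinite multiplicative order. The
  weights multiply along concatenation, so the matrices with exactly one nonzero entry in each row,
  namely the weight at position (row before, row after), form a representation of the free monoid.

  It descends to the right patience sorting monoid (\<open>row_action_cong\<close>): if \<open>R\<close> is a strictly
  increasing row, then reading \<open>R\<close> as a word builds a tableau with bottom row \<open>R\<close>, so the action
  and the weight of \<open>u\<close> at \<open>R\<close> can be read off from the tableaux of \<open>R\<close> and of \<open>R @ u\<close>, and the
  latter depends only on the class of \<open>u\<close>. It is faithful (\<open>row_action_faithful\<close>), because starting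
  from the empty row one recovers the tableau of the word. It is triangular
  (\<open>row_rank_fold_row_insert\<close>): a letter either leaves the row unchanged, or enters it while
  expelling at most one entry, which is larger; so the sum of \<open>2 ^ (n - s)\<close> over the entries \<open>s\<close>
  goes up.

  For the dimension, number the columns from \<open>0\<close>. The bottom entry of column \<open>j\<close> exceeds \<open>j\<close>, as
  the bottom row is a strictly increasing sequence of positive integers; thus only pairs with
  \<open>j < b \<le> n\<close> matter. There are \<open>n * (n + 1) / 2\<close> of these, and \<open>2 ^ n\<close> rows for each.
\<close>

section \<open>Triangular representations from weighted actions\<close>

lemma rank_increasing_enumeration:
  fixes rank :: "'q \<Rightarrow> nat"
  assumes "finite Q"
  obtains h where "bij_betw h {..<card Q} Q"
    "\<And>i j. i < card Q \<Longrightarrow> j < card Q \<Longrightarrow> rank (h i) < rank (h j) \<Longrightarrow> i < j"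
proof -
  obtain xs where xs: "set xs = Q" "distinct xs"
    using finite_distinct_list[OF assms] by blast
  define ys where "ys = sort_key rank xs"
  have ys: "set ys = Q" "distinct ys" "sorted (map rank ys)"
    using xs by (simp_all add: ys_def)
  have len: "length ys = card Q"
    using ys distinct_card by metis
  have "bij_betw ((!) ys) {..<card Q} Q"
    by (rule bij_betw_nth) (use ys len in auto)
  moreover have "i < j" if "i < card Q" "j < card Q" "rank (ys ! i) < rank (ys ! j)" for i j
    using sorted_nth_mono[OF ys(3), of j i] that len by (cases "i < j") auto
  ultimately show thesis
    by (rule that)
qed

text \<open>
  Row \<open>q\<close> of the matrix of \<open>g\<close> holds \<open>weight g q\<close> in column \<open>act g q\<close> and zeros elsewhere; the product
  of two such matrices is again of this form, with the actions composed and the weights multiplied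
  along the path. The states are numbered by increasing rank, so that leaving a state means moving
  to a larger index. The position of a nonzero weight reveals the action, which is how faithfulness
  passes from the weighted action to the matrices.
\<close>

lemma triangular_representation_of_weighted_action:
  fixes G (structure) and act :: "'g \<Rightarrow> 'q \<Rightarrow> 'q" and rank :: "'q \<Rightarrow> nat"
    and weight :: "'g \<Rightarrow> 'q \<Rightarrow> 's::comm_semiring_1"
  assumes "finite Q"
    and closed: "\<And>g q. g \<in> carrier G \<Longrightarrow> q \<in> Q \<Longrightarrow> act g q \<in> Q"
    and act_one: "\<And>q. q \<in> Q \<Longrightarrow> act \<one> q = q"
    and weight_one: "\<And>q. q \<in> Q \<Longrightarrow> weight \<one> q = 1"
    and act_mult: "\<And>g h q. g \<in> carrier G \<Longrightarrow> h \<in> carrier G \<Longrightarrow> q \<in> Q \<Longrightarrow>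
      act (g \<otimes> h) q = act h (act g q)"
    and weight_mult: "\<And>g h q. g \<in> carrier G \<Longrightarrow> h \<in> carrier G \<Longrightarrow> q \<in> Q \<Longrightarrow>
      weight (g \<otimes> h) q = weight g q * weight h (act g q)"
    and increasing: "\<And>g q. g \<in> carrier G \<Longrightarrow> q \<in> Q \<Longrightarrow> act g q = q \<or> rank q < rank (act g q)"
    and nonzero: "\<And>g q. g \<in> carrier G \<Longrightarrow> q \<in> Q \<Longrightarrow> weight g q \<noteq> 0"
    and faithful: "\<And>g h. g \<in> carrier G \<Longrightarrow> h \<in> carrier G \<Longrightarrow>
      (\<And>q. q \<in> Q \<Longrightarrow> act g q = act h q \<and> weight g q = weight h q) \<Longrightarrow> g = h"
  shows "\<exists>\<phi>. \<phi> \<in> hom G (UT (card Q) :: 's mat monoid) \<and>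
    \<phi> \<one> = \<one>\<^bsub>UT (card Q)\<^esub> \<and> inj_on \<phi> (carrier G)"
proof -
  obtain e where bij: "bij_betw e {..<card Q} Q"
    and e_less: "\<And>i j. i < card Q \<Longrightarrow> j < card Q \<Longrightarrow> rank (e i) < rank (e j) \<Longrightarrow> i < j"
    using rank_increasing_enumeration[OF \<open>finite Q\<close>] by blast
  have e_in: "e i \<in> Q" if "i < card Q" for i
    using bij that by (auto simp: bij_betw_def)
  have e_eq: "e i = e j \<longleftrightarrow> i = j" if "i < card Q" "j < card Q" for i j
    using bij that by (auto simp: bij_betw_def inj_on_def)
  have e_surj: "\<exists>i<card Q. e i = q" if "q \<in> Q" for q
    using that bij_betw_imp_surj_on[OF bij] by (metis imageE lessThan_iff)
  define \<phi> where "\<phi> g = mat (card Q) (card Q)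
    (\<lambda>(i, j). if act g (e i) = e j then weight g (e i) else 0)" for g
  have "\<phi> g \<in> carrier (UT (card Q))" if g: "g \<in> carrier G" for g
  proof -
    have "act g (e i) \<noteq> e j" if "j < i" "i < card Q" for i j
      using increasing[OF g e_in, of i] e_less[of i j] e_eq[of i j] that by auto
    then show ?thesis
      by (auto simp: UT_def \<phi>_def)
  qed
  moreover have "\<phi> (g \<otimes> h) = \<phi> g * \<phi> h" if g: "g \<in> carrier G" and h: "h \<in> carrier G" for g h
  proof (rule eq_matI)
    fix i j
    assume "i < dim_row (\<phi> g * \<phi> h)" "j < dim_col (\<phi> g * \<phi> h)"
    then have i: "i < card Q" and j: "j < card Q"
      by (simp_all add: \<phi>_def)
    obtain k where k: "k < card Q" "act g (e i) = e k"
      using e_surj[OF closed[OF g e_in[OF i]]] by metis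
    have "(\<phi> g * \<phi> h) $$ (i, j) = (\<Sum>l\<in>{0..<card Q}. \<phi> g $$ (i, l) * \<phi> h $$ (l, j))"
      using i j by (simp add: \<phi>_def scalar_prod_def)
    also have "\<dots> = (\<Sum>l\<in>{0..<card Q}. if l = k
        then weight g (e i) * (if act h (e l) = e j then weight h (e l) else 0) else 0)"
      by (rule sum.cong) (use i j k e_eq[of k] in \<open>auto simp: \<phi>_def\<close>)
    also have "\<dots> = weight g (e i) * (if act h (e k) = e j then weight h (e k) else 0)"
      using k by simp
    also have "\<dots> = \<phi> (g \<otimes> h) $$ (i, j)"
      using i j k act_mult[OF g h e_in[OF i]] weight_mult[OF g h e_in[OF i]]
      by (simp add: \<phi>_def)
    finally show "\<phi> (g \<otimes> h) $$ (i, j) = (\<phi> g * \<phi> h) $$ (i, j)" ..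
  qed (simp_all add: \<phi>_def)
  moreover have "\<phi> \<one> = \<one>\<^bsub>UT (card Q)\<^esub>"
    using act_one[OF e_in] weight_one[OF e_in] e_eq
    by (auto simp: \<phi>_def UT_def intro!: eq_matI)
  moreover have "inj_on \<phi> (carrier G)"
  proof (rule inj_onI)
    fix g h
    assume gh: "g \<in> carrier G" "h \<in> carrier G" and eq: "\<phi> g = \<phi> h"
    show "g = h"
    proof (rule faithful[OF gh])
      fix q
      assume q: "q \<in> Q"
      then obtain i where i: "i < card Q" "e i = q"
        using e_surj by blast
      obtain j where j: "j < card Q" "e j = act g q"
        using e_surj[OF closed[OF gh(1) q]] by blast
      have "\<phi> g $$ (i, j) = weight g q"
        using i j by (simp add: \<phi>_def)
      moreover have "\<phi> h $$ (i, j) = (if act h q = act g q then weight h q else 0)"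
        using i j by (simp add: \<phi>_def)
      ultimately show "act g q = act h q \<and> weight g q = weight h q"
        using eq nonzero[OF gh(1) q] by (auto split: if_splits)
    qed
  qed
  ultimately show ?thesis
    by (intro exI[of _ \<phi>]) (simp add: hom_def UT_def)
qed

section \<open>Bottom rows\<close>

fun row_insert :: "nat \<Rightarrow> nat list \<Rightarrow> nat list" where
  "row_insert a [] = [a]"
| "row_insert a (b # R) = (if a \<le> b then a # R else b # row_insert a R)"

text \<open>Columns are numbered from \<open>0\<close>; the value \<open>length R\<close> stands for a new column on the right.\<close>

definition insertion_column :: "nat \<Rightarrow> nat list \<Rightarrow> nat" where
  "insertion_column a R = length (takeWhile (\<lambda>b. b < a) R)"

text \<open>
  The number of entries \<open>b\<close> that column \<open>j\<close> gains when a word is inserted into a tableau, computed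
  from its bottom row \<open>R\<close> alone.
\<close>

fun gain :: "nat \<Rightarrow> nat \<Rightarrow> nat list \<Rightarrow> nat list \<Rightarrow> nat" where
  "gain j b R [] = 0"
| "gain j b R (a # u) =
     (if a = b \<and> insertion_column a R = j then 1 else 0) + gain j b (row_insert a R) u"

definition entry_count :: "nat \<Rightarrow> nat \<Rightarrow> tableau \<Rightarrow> nat" where
  "entry_count j b T = (if j < length T then count_list (T ! j) b else 0)"

definition increasing_rows :: "nat \<Rightarrow> nat list set" where
  "increasing_rows n = {R. sorted_wrt (<) R \<and> set R \<subseteq> {1..n}}"

text \<open>
  For a strictly increasing row over \<open>{1..n}\<close> the binary digits of this number tell which letters are
  in the row, the smallest letter being the most significant.
\<close>

definition row_rank :: "nat \<Rightarrow> nat list \<Rightarrow> nat" where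
  "row_rank n R = (\<Sum>s\<leftarrow>R. 2 ^ (n - s))"

lemma gain_append:
  "gain j b R (u @ v) = gain j b R u + gain j b (fold row_insert u R) v"
  by (induction u arbitrary: R) auto

lemma map_hd_rPS_insert: "map hd (rPS_insert a T) = row_insert a (map hd T)"
  by (induction T) auto

lemma map_hd_fold_rPS_insert:
  "map hd (fold rPS_insert u T) = fold row_insert u (map hd T)"
  by (induction u arbitrary: T) (auto simp: map_hd_rPS_insert)

lemma entry_count_Cons:
  "entry_count j b (C # T) = (case j of 0 \<Rightarrow> count_list C b | Suc i \<Rightarrow> entry_count i b T)"
  by (auto simp: entry_count_def split: nat.splits)

lemma entry_count_rPS_insert:
  "entry_count j b (rPS_insert a T) =
     entry_count j b T + (if a = b \<and> insertion_column a (map hd T) = j then 1 else 0)"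
proof (induction T arbitrary: j)
  case Nil
  then show ?case
    by (auto simp: entry_count_def insertion_column_def)
next
  case (Cons C T)
  then show ?case
    by (auto simp: entry_count_Cons insertion_column_def split: nat.splits)
qed

lemma entry_count_fold_rPS_insert:
  "entry_count j b (fold rPS_insert u T) = entry_count j b T + gain j b (map hd T) u"
  by (induction u arbitrary: T) (auto simp: entry_count_rPS_insert map_hd_rPS_insert)

lemma gain_eq_0: "b \<notin> set u \<Longrightarrow> gain j b R u = 0"
  by (induction u arbitrary: R) auto

lemma set_row_insert: "set (row_insert a R) \<subseteq> insert a (set R)"
  by (induction R) auto

lemma sorted_row_insert:
  "sorted_wrt (<) R \<Longrightarrow> sorted_wrt (<) (row_insert a R)"
proof (induction R)
  case (Cons b R)
  then show ?case
    using set_row_insert[of a R] by fastforce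
qed simp

lemma fold_row_insert_in_increasing_rows:
  "u \<in> lists {1..n} \<Longrightarrow> R \<in> increasing_rows n \<Longrightarrow> fold row_insert u R \<in> increasing_rows n"
proof (induction u arbitrary: R)
  case (Cons a u)
  then have "row_insert a R \<in> increasing_rows n"
    using set_row_insert[of a R] by (auto simp: increasing_rows_def sorted_row_insert)
  then show ?case
    using Cons by simp
qed simp

text \<open>
  A letter \<open>a\<close> that replaces some \<open>b > a\<close> changes the rank by \<open>2 ^ (n - a) - 2 ^ (n - b)\<close>, which is
  positive as \<open>b \<le> n\<close>; a letter placed at the end adds a positive term.
\<close>

lemma row_rank_row_insert:
  assumes "set R \<subseteq> {1..n}"
  shows "row_insert a R = R \<or> row_rank n R < row_rank n (row_insert a R)"
  using assms by (induction R) (auto simp: row_rank_def intro!: power_strict_increasing)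

lemma row_rank_fold_row_insert:
  assumes "u \<in> lists {1..n}" "R \<in> increasing_rows n"
  shows "fold row_insert u R = R \<or> row_rank n R < row_rank n (fold row_insert u R)"
  using assms
proof (induction u rule: rev_induct)
  case (snoc a u)
  then have "fold row_insert u R \<in> increasing_rows n"
    by (intro fold_row_insert_in_increasing_rows) auto
  then show ?case
    using snoc row_rank_row_insert[of "fold row_insert u R" n a]
    by (fastforce simp: increasing_rows_def)
qed simp

lemma increasing_rows_image: "increasing_rows n = sorted_list_of_set ` Pow {1..n}"
proof (intro equalityI subsetI)
  fix R
  assume "R \<in> increasing_rows n"
  then have "sorted_list_of_set (set R) = R" "set R \<in> Pow {1..n}"
    by (auto simp: increasing_rows_def strict_sorted_iff sorted_list_of_set.idem_if_sorted_distinct)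
  then show "R \<in> sorted_list_of_set ` Pow {1..n}"
    by (metis imageI)
next
  fix R
  assume "R \<in> sorted_list_of_set ` Pow {1..n}"
  then obtain A where "A \<subseteq> {1..n}" "R = sorted_list_of_set A"
    by auto
  then show "R \<in> increasing_rows n"
    using finite_subset[of A "{1..n}"] by (auto simp: increasing_rows_def)
qed

lemma finite_increasing_rows: "finite (increasing_rows n)"
  and card_increasing_rows: "card (increasing_rows n) = 2 ^ n"
proof -
  have "inj_on sorted_list_of_set (Pow {1..n})"
    by (rule inj_on_inverseI[of _ set]) (auto dest: finite_subset)
  then show "card (increasing_rows n) = 2 ^ n"
    by (simp add: increasing_rows_image card_image card_Pow)
qed (simp add: increasing_rows_image)

section \<open>Words acting on bottom rows\<close>

lemma P_rPS_row: "sorted_wrt (<) R \<Longrightarrow> P_rPS R = map (\<lambda>b. [b]) R"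
proof (induction R rule: rev_induct)
  case Nil
  then show ?case by (simp add: P_rPS_def)
next
  case (snoc a R)
  have "rPS_insert a (map (\<lambda>b. [b]) R) = map (\<lambda>b. [b]) R @ [[a]]" if "\<forall>b\<in>set R. b < a"
    using that by (induction R) auto
  then show ?case
    using snoc by (simp add: P_rPS_def sorted_wrt_append)
qed

text \<open>
  The row \<open>R\<close> is itself a word whose tableau has bottom row \<open>R\<close>. Congruence turns \<open>u\<close> and \<open>v\<close> into
  the words \<open>R @ u\<close> and \<open>R @ v\<close> with equal tableaux; their common bottom row is the row reached, and
  their entry counts exceed those of the tableau of \<open>R\<close> by the gains.
\<close>

lemma row_action_cong:
  assumes uv: "(u, v) \<in> rPS_rel n" and R: "R \<in> increasing_rows n"
  shows "fold row_insert u R = fold row_insert v R" "gain j b R u = gain j b R v"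
proof -
  have "(R, R) \<in> rPS_rel n"
    using R by (auto simp: increasing_rows_def rPS_rel_def)
  then have "P_rPS (R @ u) = P_rPS (R @ v)"
    using rPS_rel_append[of R R n u v] uv by (simp add: rPS_rel_def)
  then have eq: "fold rPS_insert u (P_rPS R) = fold rPS_insert v (P_rPS R)"
    by (simp add: P_rPS_def)
  have row: "map hd (P_rPS R) = R"
    using R by (simp add: increasing_rows_def P_rPS_row comp_def)
  show "fold row_insert u R = fold row_insert v R"
    using arg_cong[OF eq, of "map hd"] by (simp add: map_hd_fold_rPS_insert row)
  show "gain j b R u = gain j b R v"
    using arg_cong[OF eq, of "entry_count j b"] by (simp add: entry_count_fold_rPS_insert row)
qed

lemma strictly_sorted_nth_gt:
  "sorted_wrt (<) R \<Longrightarrow> \<forall>r\<in>set R. 0 < r \<Longrightarrow> j < length R \<Longrightarrow> j < R ! j" for R :: "nat list"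
proof (induction j)
  case (Suc j)
  then have "R ! j < R ! Suc j"
    by (auto intro: sorted_wrt_nth_less)
  with Suc show ?case by simp
qed auto

text \<open>
  The bottom row is strictly increasing and positive, so its entry number \<open>j\<close> is at least \<open>j + 1\<close>,
  and it is the smallest entry of its column. Hence only
  \<open>n * (n + 1) / 2\<close> of the \<open>n ^ 2\<close> pairs of a column and a letter need to be recorded.
\<close>

lemma entry_count_eq_0:
  assumes T: "rPS_tableau T" and "b \<le> j"
  shows "entry_count j b T = 0"
proof (cases "j < length T")
  case True
  have "\<forall>r\<in>set (map hd T). 0 < r"
    using T by (auto simp: rPS_tableau_def)
  then have "j < hd (T ! j)"
    using strictly_sorted_nth_gt[of "map hd T" j] T True by (simp add: rPS_tableau_def)
  moreover have "hd (T ! j) \<le> c" if "c \<in> set (T ! j)" for c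
  proof -
    have "sorted (T ! j)"
      using T True by (auto simp: rPS_tableau_def)
    then show ?thesis
      using that by (cases "T ! j") auto
  qed
  ultimately have "b \<notin> set (T ! j)"
    using \<open>b \<le> j\<close> by fastforce
  then show ?thesis
    by (simp add: entry_count_def)
qed (simp add: entry_count_def)

lemma tableau_eqI:
  assumes "rPS_tableau T" "rPS_tableau T'" "length T = length T'"
    and count: "\<And>j b. entry_count j b T = entry_count j b T'"
  shows "T = T'"
proof (rule nth_equalityI)
  fix j
  assume j: "j < length T"
  have "mset (T ! j) = mset (T' ! j)"
    using count[of j] j assms(3) by (intro multiset_eqI) (simp add: entry_count_def count_mset)
  moreover have "sorted (T ! j)" "sorted (T' ! j)"
    using assms j by (auto simp: rPS_tableau_def)
  ultimately show "T ! j = T' ! j"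
    by (metis properties_for_sort)
qed fact

text \<open>
  Started at the empty row, the gains are the entry counts of the tableau, and the final row has one
  entry for each column. The pairs outside \<open>j < b \<le> n\<close> have count zero for both words.
\<close>

lemma row_action_faithful:
  assumes u: "u \<in> lists {1..n}" and v: "v \<in> lists {1..n}"
    and row: "fold row_insert u [] = fold row_insert v []"
    and gain: "\<And>j b. j < b \<Longrightarrow> b \<le> n \<Longrightarrow> gain j b [] u = gain j b [] v"
  shows "(u, v) \<in> rPS_rel n"
proof -
  have T: "rPS_tableau (P_rPS u)" "rPS_tableau (P_rPS v)"
    using u v by (auto intro!: rPS_tableau_P_rPS)
  have count_gain: "entry_count j b (P_rPS w) = gain j b [] w" for j b w
    using entry_count_fold_rPS_insert[of j b w "[]"] by (simp add: P_rPS_def entry_count_def)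
  have "entry_count j b (P_rPS u) = entry_count j b (P_rPS v)" for j b
  proof -
    consider "b \<le> j" | "n < b" | "j < b" "b \<le> n"
      by linarith
    then show ?thesis
    proof cases
      case 1
      then show ?thesis
        by (simp add: T entry_count_eq_0)
    next
      case 2
      then have "b \<notin> set u" "b \<notin> set v"
        using u v by auto
      then show ?thesis
        by (simp add: count_gain gain_eq_0)
    next
      case 3
      then show ?thesis
        by (simp add: count_gain gain)
    qed
  qed
  moreover have "map hd (P_rPS u) = map hd (P_rPS v)"
    using row by (simp add: P_rPS_def map_hd_fold_rPS_insert)
  then have "length (P_rPS u) = length (P_rPS v)"
    by (metis length_map)
  ultimately have "P_rPS u = P_rPS v"
    using T tableau_eqI by blast
  then show ?thesis
    using u v by (simp add: rPS_rel_def)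
qed

section \<open>The representation\<close>

text \<open>
  A state \<open>((b, j), R)\<close> has current bottom row \<open>R\<close> and counts the letters \<open>b\<close> that enter column \<open>j\<close>;
  the pair \<open>(b, j)\<close> never changes. Taking all pairs at once makes the direct sum of the
  representations for the individual pairs.
\<close>

definition states :: "nat \<Rightarrow> ((nat \<times> nat) \<times> nat list) set" where
  "states n = (SIGMA b:{1..n}. {..<b}) \<times> increasing_rows n"

lemma finite_states: "finite (states n)"
  by (simp add: states_def finite_increasing_rows)

lemma card_states:
  assumes "n \<ge> 1"
  shows "card (states n) = 2 ^ (n - 1) * (n ^ 2 + n)"
proof -
  have "2 * (\<Sum>b = 1..n. b) = n ^ 2 + n"
    by (induction n) (auto simp: power2_eq_square)
  moreover have "card (states n) = (\<Sum>b = 1..n. b) * (2 * 2 ^ (n - 1))"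
    using assms by (simp add: states_def card_cartesian_product card_increasing_rows power_eq_if)
  ultimately show ?thesis
    by (metis mult.assoc mult.commute)
qed

theorem theorem7p4:
  fixes n :: nat
  assumes "\<exists>x :: 's::comm_semiring_1. inj (\<lambda>k::nat. x ^ k)"
    and "n \<ge> 1"
  shows "\<exists>\<phi> :: nat list set \<Rightarrow> 's mat.
    \<phi> \<in> hom (rPS n) (UT (2 ^ (n - 1) * (n ^ 2 + n))) \<and>
    \<phi> \<one>\<^bsub>rPS n\<^esub> = \<one>\<^bsub>UT (2 ^ (n - 1) * (n ^ 2 + n))\<^esub> \<and>
    inj_on \<phi> (carrier (rPS n))"
proof -
  obtain x :: 's where x: "inj (\<lambda>k::nat. x ^ k)"
    using assms(1) by blast
  have x_eq: "x ^ k = x ^ l \<longleftrightarrow> k = l" for k l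
    using inj_eq[OF x] by simp
  \<comment> \<open>A power equal to \<open>0\<close> would equal the next one.\<close>
  have x_nonzero: "x ^ k \<noteq> 0" for k
    using x_eq[of k "Suc k"] by auto
  define rep where "rep A = (SOME u. u \<in> A)" for A :: "nat list set"
  define act where "act A = (\<lambda>((b, j), R). ((b :: nat, j :: nat), fold row_insert (rep A) R))" for A
  define weight where "weight A = (\<lambda>((b, j), R). x ^ gain j b R (rep A))" for A
  have rep_class: "(u, rep (rPS_rel n `` {u})) \<in> rPS_rel n" if "u \<in> lists {1..n}" for u
    using someI[of "\<lambda>v. v \<in> rPS_rel n `` {u}" u] equiv_class_self[OF equiv_rPS_rel that]
    by (simp add: rep_def)
  have act_class: "act (rPS_rel n `` {u}) ((b, j), R) = ((b, j), fold row_insert u R)"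
    and weight_class: "weight (rPS_rel n `` {u}) ((b, j), R) = x ^ gain j b R u"
    if "u \<in> lists {1..n}" "R \<in> increasing_rows n" for u b j R
    using row_action_cong[OF rep_class] that by (simp_all add: act_def weight_def)
  have states_iff: "((b, j), R) \<in> states n \<longleftrightarrow> j < b \<and> b \<le> n \<and> R \<in> increasing_rows n" for b j R
    by (auto simp: states_def)
  have nil_in: "[] \<in> increasing_rows n"
    by (simp add: increasing_rows_def)
  have "\<exists>\<phi>. \<phi> \<in> hom (rPS n) (UT (card (states n)) :: 's mat monoid) \<and>
    \<phi> \<one>\<^bsub>rPS n\<^esub> = \<one>\<^bsub>UT (card (states n))\<^esub> \<and> inj_on \<phi> (carrier (rPS n))"
  proof (rule triangular_representation_of_weighted_action[where act = act and weight = weight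
        and rank = "\<lambda>(_, R). row_rank n R"])
    show "finite (states n)"
      by (rule finite_states)
  next
    fix q
    assume "q \<in> states n"
    then obtain b j R where q: "q = ((b, j), R)" "j < b" "b \<le> n" "R \<in> increasing_rows n"
      by (metis states_iff surj_pair)
    show "act \<one>\<^bsub>rPS n\<^esub> q = q" "weight \<one>\<^bsub>rPS n\<^esub> q = 1"
      using act_class[of "[]" R b j] weight_class[of "[]" R b j] q by (simp_all add: one_rPS)
    fix A
    assume "A \<in> carrier (rPS n)"
    then obtain u where u: "u \<in> lists {1..n}" "A = rPS_rel n `` {u}"
      by (rule carrier_rPS_cases)
    note q_u = act_class[OF u(1) q(4)] weight_class[OF u(1) q(4)]
    have uR: "fold row_insert u R \<in> increasing_rows n"
      using fold_row_insert_in_increasing_rows u q by blast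
    show "act A q \<in> states n"
      using q u uR by (simp add: q_u states_iff)
    show "act A q = q \<or> (case q of (_, R) \<Rightarrow> row_rank n R) < (case act A q of (_, R) \<Rightarrow> row_rank n R)"
      using row_rank_fold_row_insert[OF u(1) q(4)] by (simp add: q u q_u)
    show "weight A q \<noteq> 0"
      by (simp add: q u q_u x_nonzero)
    fix B
    assume "B \<in> carrier (rPS n)"
    then obtain v where v: "v \<in> lists {1..n}" "B = rPS_rel n `` {v}"
      by (rule carrier_rPS_cases)
    have uv: "u @ v \<in> lists {1..n}"
      using u v by simp
    note AB = rPS_mult_class[OF u(1) v(1)]
    show "act (A \<otimes>\<^bsub>rPS n\<^esub> B) q = act B (act A q)"
      using act_class[OF uv q(4)] act_class[OF v(1) uR]
      by (simp add: AB q_u q(1) u(2) v(2))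
    show "weight (A \<otimes>\<^bsub>rPS n\<^esub> B) q = weight A q * weight B (act A q)"
      using weight_class[OF uv q(4)] weight_class[OF v(1) uR]
      by (simp add: AB q_u q(1) u(2) v(2) gain_append power_add)
  next
    fix A B
    assume "A \<in> carrier (rPS n)" "B \<in> carrier (rPS n)"
      and same: "\<And>q. q \<in> states n \<Longrightarrow> act A q = act B q \<and> weight A q = weight B q"
    then obtain u v where u: "u \<in> lists {1..n}" "A = rPS_rel n `` {u}"
      and v: "v \<in> lists {1..n}" "B = rPS_rel n `` {v}"
      by (metis carrier_rPS_cases)
    have from_empty: "fold row_insert u [] = fold row_insert v [] \<and> gain j b [] u = gain j b [] v"
      if "j < b" "b \<le> n" for j b
      using same[of "((b, j), [])"] that nil_in
      by (simp add: states_iff u(2) v(2) x_eq act_class[OF u(1) nil_in] act_class[OF v(1) nil_in]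
          weight_class[OF u(1) nil_in] weight_class[OF v(1) nil_in])
    \<comment> \<open>Since \<open>n \<ge> 1\<close>, there is a pair, namely \<open>b = 1\<close> and \<open>j = 0\<close>, whose states show the row.\<close>
    have "(u, v) \<in> rPS_rel n"
      using from_empty row_action_faithful[OF u(1) v(1)] from_empty[of 0 1] assms(2) by simp
    then show "A = B"
      using u v equiv_class_eq[OF equiv_rPS_rel] by blast
  qed
  then show ?thesis
    by (simp add: card_states[OF assms(2)])
qed

end
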